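(* Let $0<\Delta<1$, $\alpha=1-\Delta$, and $F_{(\alpha)}>0$. Let $x_1,\dots,x_k$ be i.i.d. positive random variables with Laplace transform $E(e^{-s x_j})=\exp(-F_{(\alpha)}s^\alpha)$, $s\ge0$ (so that $E(x_j^\lambda)=F_{(\alpha)}^{\lambda/\alpha}\Gamma(1-\lambda/\alpha)/\Gamma(1-\lambda)$ for $\lambda<\alpha$), and let $$\hat F_{(\alpha)}=\frac{1}{\Delta^\Delta}\left[\frac{k}{\sum_{j=1}^k x_j^{-\alpha/\Delta}}\right]^\Delta.$$ Write $c_n=\frac{\Gamma(1+n/\Delta)}{\Gamma(1+n\alpha/\Delta)}$. Then for any $\epsilon>0$, $$\Pr\big(\hat F_{(\alpha)}\ge(1+\epsilon)F_{(\alpha)}\big)\le\exp\!\left(-k\frac{\epsilon^2}{G_R}\right),\qquad \frac{\epsilon^2}{G_R}=-\left(\log\sum_{n=0}^\infty\frac{(-t_R)^n}{n!}c_n+\frac{t_R}{(1+\epsilon)^{1/\Delta}\Delta}\right),$$ where $t_R$ is the solution to $$\frac{\sum_{n=1}^\infty\frac{(-1)^n t_R^{\,n-1}}{(n-1)!}c_n}{\sum_{n=0}^\infty\frac{(-t_R)^n}{n!}c_n}+\frac{1}{(1+\epsilon)^{1/\Delta}\Delta}=0;$$ and for any $0<\epsilon<1$, $$\Pr\big(\hat F_{(\alpha)}\le(1-\epsilon)F_{(\alpha)}\big)\le\exp\!\left(-k\frac{\epsilon^2}{G_L}\right),\qquad \frac{\epsilon^2}{G_L}=-\log\sum_{n=0}^\infty\frac{t_L^{\,n}}{n!}c_n+\frac{t_L}{(1-\epsilon)^{1/\Delta}\Delta},$$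 where $t_L$ is the solution to $$-\frac{\sum_{n=1}^\infty\frac{t_L^{\,n-1}}{(n-1)!}c_n}{\sum_{n=0}^\infty\frac{t_L^{\,n}}{n!}c_n}+\frac{1}{(1-\epsilon)^{1/\Delta}\Delta}=0.$$
   Context: In the application, $F_{(\alpha)}=\sum_i A[i]^\alpha$ for a nonnegative data vector $A$, and $x_j=\sum_i r_{ij}A[i]$ where $r_{ij}=\frac{\sin(\alpha v_{ij})}{[\sin v_{ij}]^{1/\alpha}}[\sin(v_{ij}\Delta)/w_{ij}]^{\Delta/\alpha}$ with $v_{ij}\sim\mathrm{Uniform}(0,\pi)$, $w_{ij}\sim\mathrm{Exp}(1)$ all independent; such $x_j$ have the stated Laplace transform.
   Formalization: The right tail bound is stated for those ε>0 for which t_R exists with both series convergent (shown for all small ε, with uniqueness), not for any ε>0; e.g. for Δ=1/2 no such t_R exists once ε≥√2−1. *)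

theory Defs
  imports "HOL-Probability.Probability"
begin

text \<open>
  The sample \<open>x 1, \<dots>, x k\<close> is a function on \<open>nat\<close> of which only the indices \<open>{1..k}\<close> are used.
\<close>
definition F_hat :: "real \<Rightarrow> real \<Rightarrow> nat \<Rightarrow> (nat \<Rightarrow> real) \<Rightarrow> real" where
  "F_hat \<alpha> \<Delta> k x =
     1 / (\<Delta> powr \<Delta>) * (real k / (\<Sum>j = 1..k. x j powr (- (\<alpha> / \<Delta>)))) powr \<Delta>"

definition c :: "real \<Rightarrow> real \<Rightarrow> nat \<Rightarrow> real" where
  "c \<alpha> \<Delta> n = Gamma (1 + real n / \<Delta>) / Gamma (1 + real n * \<alpha> / \<Delta>)"

text \<open>
  The power series with coefficients \<open>c \<alpha> \<Delta> n / fact n\<close> has a finite radius of convergence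
  and \<open>suminf\<close> is meaningless outside it, so a solution of one of the two equations below is
  required to be a point where both of the series involved converge.
  The series that start at 1 are written with \<open>n + 1\<close> in place of \<open>n\<close>.
  A vanishing denominator cannot produce a spurious solution: the quotient would be 0, and the
  remaining summand is positive.
\<close>
definition solves_right :: "real \<Rightarrow> real \<Rightarrow> real \<Rightarrow> real \<Rightarrow> bool" where
  "solves_right \<alpha> \<Delta> \<epsilon> t \<longleftrightarrow>
     summable (\<lambda>n. (- t) ^ n / fact n * c \<alpha> \<Delta> n) \<and>
     summable (\<lambda>n. (- 1) ^ (n + 1) * t ^ n / fact n * c \<alpha> \<Delta> (n + 1)) \<and>
     (\<Sum>n. (- 1) ^ (n + 1) * t ^ n / fact n * c \<alpha> \<Delta> (n + 1)) /
       (\<Sum>n. (- t) ^ n / fact n * c \<alpha> \<Delta> n)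
     + 1 / ((1 + \<epsilon>) powr (1 / \<Delta>) * \<Delta>) = 0"

definition solves_left :: "real \<Rightarrow> real \<Rightarrow> real \<Rightarrow> real \<Rightarrow> bool" where
  "solves_left \<alpha> \<Delta> \<epsilon> t \<longleftrightarrow>
     summable (\<lambda>n. t ^ n / fact n * c \<alpha> \<Delta> n) \<and>
     summable (\<lambda>n. t ^ n / fact n * c \<alpha> \<Delta> (n + 1)) \<and>
     - ((\<Sum>n. t ^ n / fact n * c \<alpha> \<Delta> (n + 1)) / (\<Sum>n. t ^ n / fact n * c \<alpha> \<Delta> n))
     + 1 / ((1 - \<epsilon>) powr (1 / \<Delta>) * \<Delta>) = 0"

end

theory Submission
  imports Defs
begin

text \<open>
  Let \<open>Y = F\<^bsup>1/\<Delta>\<^esup> x\<^bsup>-\<alpha>/\<Delta>\<^esup>\<close>. The moment formula gives \<open>E Y\<^sup>n = c\<^sub>n\<close>, so the power series of the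
  theorem is the moment generating function of \<open>Y\<close>, the two tail events are
  \<open>Y\<^sub>1 + \<dots> + Y\<^sub>k \<le> k r\<close> and \<open>Y\<^sub>1 + \<dots> + Y\<^sub>k \<ge> k r\<close> with \<open>r = 1 / ((1 \<plusminus> \<epsilon>)\<^bsup>1/\<Delta>\<^esup> \<Delta>)\<close>, and the
  bounds are Chernoff bounds. The equation for \<open>t\<close> says that \<open>E (Y - r) e\<^bsup>t(Y - r)\<^esup> = 0\<close>. The left
  side is strictly increasing in \<open>t\<close> because \<open>Y\<close> is not almost surely constant, which gives
  uniqueness and the sign of \<open>t\<close>. A solution exists for every \<open>r > 1 / \<Delta> = E Y\<close> because the
  moment generating function diverges at its radius of convergence \<open>R\<close>.
\<close>

section \<open>Gamma integrals\<close>

text \<open>Euler's integral for \<open>Gamma q\<close> under the substitution t = F * s^a,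
  multiplied afterwards by F^(-q) / a.\<close>

lemma has_integral_powr_exp_powr:
  fixes a q F :: real
  assumes "a > 0" "q > 0" "F > 0"
  shows "((\<lambda>s. s powr (a * q - 1) * exp (- F * s powr a)) has_integral
           Gamma q * F powr (- q) / a) {0<..}"
proof -
  define g where "g = (\<lambda>s::real. F * s powr a)"
  define g' where "g' = (\<lambda>s::real. F * a * s powr (a - 1))"
  define f where "f = (\<lambda>t::real. t powr (q - 1) / exp t)"
  have img: "g ` {0<..} = {0<..}"
  proof
    show "{0<..} \<subseteq> g ` {0<..}"
    proof
      fix y :: real assume "y \<in> {0<..}"
      then have "y = g ((y / F) powr (1 / a))" "(y / F) powr (1 / a) \<in> {0<..}"
        using assms by (auto simp: g_def powr_powr)
      then show "y \<in> g ` {0<..}" by blast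
    qed
  qed (use assms in \<open>auto simp: g_def\<close>)
  have "(f has_integral Gamma q) {0..}"
    unfolding f_def by (rule Gamma_integral_real) fact
  \<comment> \<open>The point 0 is dropped because the substitution is differentiable and injective
    on the open half-line, which it maps onto itself.\<close>
  then have hf: "(f has_integral Gamma q) {0<..}"
    by (subst (asm) has_integral_spike_set_eq[where T = "{0<..}"])
       (auto intro!: negligible_subset[OF negligible_sing[of 0]])
  have "f absolutely_integrable_on {0<..}"
    by (rule nonnegative_absolutely_integrable_1) (use hf in \<open>auto simp: f_def has_integral_integrable\<close>)
  with hf img have "f absolutely_integrable_on (g ` {0<..}) \<and> integral (g ` {0<..}) f = Gamma q"
    by (simp add: integral_unique)
  also have "?this \<longleftrightarrow> (\<lambda>s. \<bar>g' s\<bar> * f (g s)) absolutely_integrable_on {0<..} \<and>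
       integral {0<..} (\<lambda>s. \<bar>g' s\<bar> * f (g s)) = Gamma q"
  proof (rule has_absolute_integral_change_of_variables_1'[symmetric])
    show "inj_on g {0<..}"
    proof (rule inj_on_inverseI[where g = "\<lambda>y. (y / F) powr (1 / a)"])
      show "(g s / F) powr (1 / a) = s" if "s \<in> {0<..}" for s
        using that assms by (simp add: g_def powr_powr)
    qed
    show "(g has_field_derivative g' s) (at s within {0<..})" if "s \<in> {0<..}" for s
      unfolding g_def g'_def using that
      by (auto intro!: derivative_eq_intros simp: field_simps)
  qed auto
  finally have "((\<lambda>s. \<bar>g' s\<bar> * f (g s)) has_integral Gamma q) {0<..}"
    by (metis integrable_integral set_lebesgue_integral_eq_integral(1))
  then have "((\<lambda>s. \<bar>g' s\<bar> * f (g s) * (F powr (- q) / a)) has_integral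
      Gamma q * (F powr (- q) / a)) {0<..}"
    by (rule has_integral_mult_left)
  moreover have "\<bar>g' s\<bar> * f (g s) * (F powr (- q) / a) = s powr (a * q - 1) * exp (- F * s powr a)"
    if "s \<in> {0<..}" for s
  proof -
    have "a * q - 1 = (a - 1) + a * (q - 1)" by (simp add: algebra_simps)
    then have "s powr (a * q - 1) = s powr (a - 1) * s powr (a * (q - 1))"
      by (simp only: powr_add)
    moreover have "F * F powr (q - 1) * F powr (- q) = 1"
      using assms by (simp add: powr_mult_base powr_minus)
    ultimately show ?thesis
      using that assms
      by (simp add: g_def g'_def f_def powr_mult powr_powr exp_minus divide_simps)
  qed
  ultimately show ?thesis
    by (subst (asm) has_integral_cong) auto
qed

lemma nn_integral_powr_exp_powr:
  fixes a q F :: real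
  assumes "a > 0" "q > 0" "F > 0"
  shows "(\<integral>\<^sup>+s\<in>{0<..}. ennreal (s powr (a * q - 1) * exp (- F * s powr a)) \<partial>lborel) =
           ennreal (Gamma q * F powr (- q) / a)"
  by (rule nn_integral_has_integral_lebesgue'[OF _ has_integral_powr_exp_powr]) (use assms in auto)

text \<open>Integration by parts in the form of Tonelli: 1 - exp (- F * s^a) is the integral of its
  derivative \<open>h\<close> over 0 < u < s. Integrating over s > u first leaves u^(-a*q) / (a*q),
  and what remains is the preceding integral with 1 - q in place of q.\<close>

lemma nn_integral_powr_one_minus_exp_powr:
  fixes a q F :: real
  assumes "a > 0" "0 < q" "q < 1" "F > 0"
  shows "(\<integral>\<^sup>+s\<in>{0<..}. ennreal (s powr (- a * q - 1) * (1 - exp (- F * s powr a))) \<partial>lborel) =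
           ennreal (F powr q * Gamma (1 - q) / (a * q))"
proof -
  define h where "h = (\<lambda>u::real. F * a * u powr (a - 1) * exp (- F * u powr a))"
  have h_nonneg: "h u \<ge> 0" for u
    using assms by (simp add: h_def)
  have [measurable]: "h \<in> borel_measurable borel"
    unfolding h_def by measurable
  have inner: "(\<integral>\<^sup>+u\<in>{0<..<s}. ennreal (h u) \<partial>lborel) = ennreal (1 - exp (- F * s powr a))"
    if "s > 0" for s
  proof (rule nn_integral_has_integral_lebesgue')
    \<comment> \<open>The interior version of the fundamental theorem is needed because u^a has no
      derivative at 0 when a < 1.\<close>
    have "(h has_integral - exp (- F * s powr a) - - exp (- F * 0 powr a)) {0..s}"
    proof (rule fundamental_theorem_of_calculus_interior)
      show "continuous_on {0..s} (\<lambda>s. - exp (- F * s powr a))"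
        using assms by (intro continuous_intros continuous_on_powr') auto
      show "((\<lambda>s. - exp (- F * s powr a)) has_vector_derivative h u) (at u)"
        if "u \<in> {0<..<s}" for u
        using that unfolding h_def has_real_derivative_iff_has_vector_derivative[symmetric]
        by (auto intro!: derivative_eq_intros simp: field_simps)
    qed (use that in auto)
    then show "(h has_integral 1 - exp (- F * s powr a)) {0<..<s}"
      by (simp add: has_integral_Icc_iff_Ioo)
  qed (rule h_nonneg)
  have outer: "(\<integral>\<^sup>+s\<in>{u..}. ennreal (s powr (- a * q - 1)) \<partial>lborel) =
      ennreal (u powr (- a * q) / (a * q))" if "u > 0" for u
    using nn_integral_has_integral_lebesgue'[OF _ has_integral_powr_to_inf[of "- a * q - 1" u]] 
      that assms by simp
  have "(\<integral>\<^sup>+s\<in>{0<..}. ennreal (s powr (- a * q - 1) * (1 - exp (- F * s powr a))) \<partial>lborel) =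
     (\<integral>\<^sup>+s. (\<integral>\<^sup>+u. ennreal (s powr (- a * q - 1)) * ennreal (h u) *
        indicator {(s, u). 0 < u \<and> u < s} (s, u) \<partial>lborel) \<partial>lborel)"
  proof (intro nn_integral_cong)
    fix s :: real
    show "ennreal (s powr (- a * q - 1) * (1 - exp (- F * s powr a))) * indicator {0<..} s =
      (\<integral>\<^sup>+u. ennreal (s powr (- a * q - 1)) * ennreal (h u) *
        indicator {(s, u). 0 < u \<and> u < s} (s, u) \<partial>lborel)"
    proof (cases "s > 0")
      case True
      have "(\<integral>\<^sup>+u. ennreal (s powr (- a * q - 1)) * ennreal (h u) *
          indicator {(s, u). 0 < u \<and> u < s} (s, u) \<partial>lborel) =
          (\<integral>\<^sup>+u. ennreal (s powr (- a * q - 1)) * (ennreal (h u) * indicator {0<..<s} u) \<partial>lborel)"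
        by (intro nn_integral_cong) (auto split: split_indicator)
      also have "\<dots> = ennreal (s powr (- a * q - 1)) * ennreal (1 - exp (- F * s powr a))"
        using inner[OF True] by (simp add: nn_integral_cmult)
      finally show ?thesis
        using True by (simp add: ennreal_mult')
    next
      case False
      have "(\<integral>\<^sup>+u. ennreal (s powr (- a * q - 1)) * ennreal (h u) *
          indicator {(s, u). 0 < u \<and> u < s} (s, u) \<partial>lborel) = (\<integral>\<^sup>+u. 0 \<partial>(lborel :: real measure))"
        using False by (intro nn_integral_cong) (auto split: split_indicator)
      then show ?thesis using False by simp
    qed
  qed
  also have "\<dots> = (\<integral>\<^sup>+u. (\<integral>\<^sup>+s. ennreal (s powr (- a * q - 1)) * ennreal (h u) *
        indicator {(s, u). 0 < u \<and> u < s} (s, u) \<partial>lborel) \<partial>lborel)"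
    by (rule lborel_pair.Fubini') measurable
  also have "\<dots> = (\<integral>\<^sup>+u. ennreal (F / q) *
      (ennreal (u powr (a * (1 - q) - 1) * exp (- F * u powr a)) * indicator {0<..} u) \<partial>lborel)"
  proof (intro nn_integral_cong)
    fix u :: real
    show "(\<integral>\<^sup>+s. ennreal (s powr (- a * q - 1)) * ennreal (h u) *
        indicator {(s, u). 0 < u \<and> u < s} (s, u) \<partial>lborel) = ennreal (F / q) *
      (ennreal (u powr (a * (1 - q) - 1) * exp (- F * u powr a)) * indicator {0<..} u)"
    proof (cases "u > 0")
      case True
      \<comment> \<open>The strict inequality u < s is traded for the closed half-line of
        \<open>outer\<close>; they differ only at the null point s = u.\<close>
      have "(\<integral>\<^sup>+s. ennreal (s powr (- a * q - 1)) * ennreal (h u) *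
          indicator {(s, u). 0 < u \<and> u < s} (s, u) \<partial>lborel) =
          (\<integral>\<^sup>+s. ennreal (h u) * (ennreal (s powr (- a * q - 1)) * indicator {u..} s) \<partial>lborel)"
        using True AE_lborel_singleton[of u]
        by (intro nn_integral_cong_AE) (auto split: split_indicator simp: mult_ac)
      also have "\<dots> = ennreal (h u) * ennreal (u powr (- a * q) / (a * q))"
        using outer[OF True] by (simp add: nn_integral_cmult)
      also have "\<dots> = ennreal (h u * (u powr (- a * q) / (a * q)))"
        by (rule ennreal_mult'[symmetric, OF h_nonneg])
      also have "h u * (u powr (- a * q) / (a * q)) =
          F / q * (u powr (a * (1 - q) - 1) * exp (- F * u powr a))"
      proof -
        have "a * (1 - q) - 1 = (a - 1) + (- a * q)" by (simp add: algebra_simps)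
        then have "u powr (a * (1 - q) - 1) = u powr (a - 1) * u powr (- a * q)"
          by (simp only: powr_add)
        then show ?thesis using assms by (simp add: h_def)
      qed
      also have "ennreal \<dots> = ennreal (F / q) *
          ennreal (u powr (a * (1 - q) - 1) * exp (- F * u powr a))"
        using assms by (intro ennreal_mult') auto
      finally show ?thesis
        using True by simp
    next
      case False
      have "(\<integral>\<^sup>+s. ennreal (s powr (- a * q - 1)) * ennreal (h u) *
          indicator {(s, u). 0 < u \<and> u < s} (s, u) \<partial>lborel) = (\<integral>\<^sup>+s. 0 \<partial>(lborel :: real measure))"
        using False by (intro nn_integral_cong) (auto split: split_indicator)
      then show ?thesis using False by simp
    qed
  qed
  also have "\<dots> = ennreal (F / q) * ennreal (Gamma (1 - q) * F powr (- (1 - q)) / a)"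
    using nn_integral_powr_exp_powr[of a "1 - q" F] assms by (simp add: nn_integral_cmult)
  also have "\<dots> = ennreal (F powr q * Gamma (1 - q) / (a * q))"
    using assms by (simp add: ennreal_mult'[symmetric] powr_diff mult.commute)
  finally show ?thesis .
qed

section \<open>The power series with coefficients \<open>c n / n!\<close>\<close>

locale conjugate_exponents =
  fixes \<alpha> \<Delta> :: real
  assumes \<Delta>_pos: "0 < \<Delta>" and \<Delta>_less_1: "\<Delta> < 1" and \<alpha>_def: "\<alpha> = 1 - \<Delta>"
begin

lemma \<alpha>_pos: "0 < \<alpha>" and \<alpha>_less_1: "\<alpha> < 1"
  using \<Delta>_pos \<Delta>_less_1 by (simp_all add: \<alpha>_def)

text \<open>
  The maximum of \<open>t\<^bsup>\<alpha>/\<Delta>\<^esup> (1 - t)\<close> on the unit interval, attained at \<open>t = \<alpha>\<close>. It is the radius of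
  convergence because \<open>n! / c n\<close> is, up to a linear factor, the integral of the \<open>n\<close>-th power of
  that function.
\<close>
definition R :: real where
  "R = \<Delta> * \<alpha> powr (\<alpha> / \<Delta>)"

definition a :: "nat \<Rightarrow> real" where
  "a n = c \<alpha> \<Delta> n / fact n"

lemma diffs_a: "diffs a n = c \<alpha> \<Delta> (n + 1) / fact n"
  by (simp add: diffs_def a_def)

lemma R_pos: "0 < R"
  using \<Delta>_pos \<alpha>_pos by (simp add: R_def)

definition mgf :: "real \<Rightarrow> real" where
  "mgf t = (\<Sum>n. a n * t ^ n)"

definition mgf' :: "real \<Rightarrow> real" where
  "mgf' t = (\<Sum>n. diffs a n * t ^ n)"

text \<open>
  The derivative of \<open>exp (- t * r) * mgf t\<close>, which turns out to be \<open>E (Y - r) e\<^bsup>t(Y - r)\<^esup>\<close>.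
\<close>
definition tilted :: "real \<Rightarrow> real \<Rightarrow> real" where
  "tilted r t = exp (- t * r) * (mgf' t - r * mgf t)"

section \<open>The radius of convergence, via a Beta integral\<close>

definition g :: "real \<Rightarrow> real" where
  "g t = t powr (\<alpha> / \<Delta>) * (1 - t)"

lemma g_nonneg: "t \<le> 1 \<Longrightarrow> 0 \<le> g t"
  by (simp add: g_def)

text \<open>Weighted AM-GM: ln y \<le> y - 1 is applied at t / \<alpha> and (1 - t) / \<Delta>. With
  weights \<alpha> / \<Delta> and 1 the right sides add up to (1 - \<alpha> - \<Delta>) / \<Delta> =
  0.\<close>

lemma g_le_R:
  assumes "0 < t" "t < 1"
  shows "g t \<le> R"
proof -
  have "(\<alpha> / \<Delta>) * ln (t / \<alpha>) + ln ((1 - t) / \<Delta>) \<le> (\<alpha> / \<Delta>) * (t / \<alpha> - 1) + ((1 - t) / \<Delta> - 1)"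
    using assms \<alpha>_pos \<Delta>_pos by (intro add_mono mult_left_mono ln_le_minus_one) auto
  also have "\<dots> = 0"
    using \<alpha>_pos \<Delta>_pos by (simp add: field_simps) (simp add: \<alpha>_def algebra_simps)
  finally have "(\<alpha> / \<Delta>) * ln (t / \<alpha>) + ln ((1 - t) / \<Delta>) \<le> 0" .
  moreover have "ln (t / \<alpha>) = ln t - ln \<alpha>" "ln ((1 - t) / \<Delta>) = ln (1 - t) - ln \<Delta>"
    using assms \<alpha>_pos \<Delta>_pos by (simp_all add: ln_div)
  moreover have "ln (g t) = \<alpha> / \<Delta> * ln t + ln (1 - t)"
    unfolding g_def using assms by (subst ln_mult) auto
  moreover have "ln R = ln \<Delta> + \<alpha> / \<Delta> * ln \<alpha>"
    unfolding R_def using \<alpha>_pos \<Delta>_pos by (subst ln_mult) auto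
  ultimately have "ln (g t) \<le> ln R"
    by (simp only: right_diff_distrib)
  then show ?thesis
    using assms R_pos by (subst (asm) ln_le_cancel_iff) (auto simp: g_def)
qed

lemma a_pos: "0 < a n"
  unfolding a_def c_def using \<alpha>_pos \<Delta>_pos
  by (intro divide_pos_pos Gamma_real_pos add_pos_nonneg) auto

lemma a_nonneg: "0 \<le> a n"
  using a_pos[of n] by simp

text \<open>A Beta integral with parameters n\<alpha>/\<Delta> + 1 and n + 1. Since
  \<alpha>/\<Delta> + 1 = 1/\<Delta>, these add up to n/\<Delta> + 2, one more than the argument in
  the numerator of \<open>c\<close>; the functional equation of Gamma produces the linear
  factor.\<close>

lemma has_integral_g_power:
  "((\<lambda>t. g t ^ n) has_integral 1 / ((real n / \<Delta> + 1) * a n)) {0<..<1}"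
proof -
  define b where "b = real n * \<alpha> / \<Delta>"
  have b: "b \<ge> 0" "b + real n = real n / \<Delta>"
    using \<alpha>_pos \<Delta>_pos by (simp_all add: b_def field_simps) (simp add: \<alpha>_def algebra_simps)
  have "((\<lambda>t. t powr (b + 1 - 1) * (1 - t) powr (real n + 1 - 1)) has_integral
      Beta (b + 1) (real n + 1)) {0<..<1}"
    using has_integral_Beta_real[of "b + 1" "real n + 1"] b by (simp add: has_integral_Icc_iff_Ioo)
  also have "?this \<longleftrightarrow> ((\<lambda>t. g t ^ n) has_integral Beta (b + 1) (real n + 1)) {0<..<1}"
  proof (rule has_integral_cong)
    fix t :: real assume "t \<in> {0<..<1}"
    then have "g t ^ n = (t powr (\<alpha> / \<Delta>)) powr real n * (1 - t) powr real n"
      by (simp add: g_def powr_realpow power_mult_distrib)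
    then show "t powr (b + 1 - 1) * (1 - t) powr (real n + 1 - 1) = g t ^ n"
      by (simp add: powr_powr b_def mult.commute)
  qed
  also have "Beta (b + 1) (real n + 1) = 1 / ((real n / \<Delta> + 1) * a n)"
  proof -
    have pos: "real n / \<Delta> + 1 > 0" using \<Delta>_pos by (simp add: add_nonneg_pos)
    then have "Gamma (real n / \<Delta> + 1 + 1) = (real n / \<Delta> + 1) * Gamma (real n / \<Delta> + 1)"
      by (intro Gamma_plus1) (auto dest: nonpos_Ints_nonpos)
    moreover have "Gamma (real n + 1) = fact n"
      using Gamma_fact[of n, where 'a = real] by (simp add: add.commute)
    moreover have "b + 1 + (real n + 1) = real n / \<Delta> + 1 + 1"
      using b by simp
    ultimately show ?thesis
      unfolding Beta_def by (simp add: a_def c_def b_def add.commute)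
  qed
  finally show ?thesis .
qed

text \<open>Bounding the integrand g^n by R^n bounds the integral from above, hence its reciprocal
  \<open>a n\<close> from below.\<close>

lemma a_R_power_ge: "1 / (real n / \<Delta> + 1) \<le> a n * R ^ n"
proof -
  have pos: "real n / \<Delta> + 1 > 0" using \<Delta>_pos by (simp add: add_nonneg_pos)
  have "((\<lambda>t. R ^ n) has_integral R ^ n) {0<..<1::real}"
    using has_integral_const_real[of "R ^ n" 0 1] by (simp add: has_integral_Icc_iff_Ioo)
  with has_integral_g_power have "1 / ((real n / \<Delta> + 1) * a n) \<le> R ^ n"
    by (rule has_integral_le) (auto intro!: power_mono g_le_R g_nonneg)
  then show ?thesis
    using pos a_pos[of n] by (simp add: divide_simps mult_ac)
qed

text \<open>For R' < R the function \<open>g\<close> exceeds R' on an interval of some length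
  \<delta> next to its maximum, so the integral of g^n is at least \<delta> * R'^n. Thus a n * R'^n
  stays bounded and a geometric series dominates.\<close>

lemma summable_a:
  assumes "\<bar>t\<bar> < R"
  shows "summable (\<lambda>n. a n * t ^ n)"
proof -
  define R' where "R' = (\<bar>t\<bar> + R) / 2"
  have R': "\<bar>t\<bar> < R'" "R' < R" "0 < R'"
    using assms by (auto simp: R'_def)
  have "isCont g \<alpha>"
    unfolding g_def using \<alpha>_pos by (intro continuous_intros) auto
  moreover have "g \<alpha> = R"
    unfolding g_def R_def by (subst (2) \<alpha>_def) simp
  ultimately have "\<forall>\<^sub>F u in at \<alpha>. R' < g u"
    using R' by (auto simp: isCont_def dest: order_tendstoD)
  then obtain d where d: "d > 0" "\<And>u. u \<noteq> \<alpha> \<Longrightarrow> dist u \<alpha> < d \<Longrightarrow> R' < g u"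
    unfolding eventually_at by auto
  \<comment> \<open>The interval (\<alpha>, \<alpha> + \<delta>) lies on one side of \<alpha>
    because the neighbourhood obtained excludes \<alpha> itself; the bound \<Delta> / 2 keeps it
    inside the unit interval.\<close>
  define \<delta> where "\<delta> = min (d / 2) (\<Delta> / 2)"
  have \<delta>: "0 < \<delta>" "\<delta> < d" "\<alpha> + \<delta> < 1"
    using d \<Delta>_pos by (auto simp: \<delta>_def \<alpha>_def min_def)
  have lower: "\<delta> * R' ^ n \<le> 1 / ((real n / \<Delta> + 1) * a n)" for n
  proof -
    have int: "(\<lambda>t. g t ^ n) integrable_on {0<..<1}"
      using has_integral_g_power by blast
    have sub: "{\<alpha><..<\<alpha> + \<delta>} \<subseteq> {0<..<1}"
      using \<delta> \<alpha>_pos by auto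
    have int': "(\<lambda>t. g t ^ n) integrable_on {\<alpha><..<\<alpha> + \<delta>}"
      using integrable_on_subinterval[of "\<lambda>t. g t ^ n" "{0..1}" \<alpha> "\<alpha> + \<delta>"] int \<delta> \<alpha>_pos
      by (simp add: integrable_on_Icc_iff_Ioo)
    have "((\<lambda>t. R' ^ n) has_integral \<delta> * R' ^ n) {\<alpha><..<\<alpha> + \<delta>}"
      using has_integral_const_real[of "R' ^ n" \<alpha> "\<alpha> + \<delta>"] \<delta> by (simp add: has_integral_Icc_iff_Ioo)
    then have "\<delta> * R' ^ n \<le> integral {\<alpha><..<\<alpha> + \<delta>} (\<lambda>t. g t ^ n)"
      using int' \<delta> R'
      by (intro has_integral_le[OF _ integrable_integral])
         (auto intro!: power_mono less_imp_le[OF d(2)] simp: dist_real_def)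
    also have "\<dots> \<le> integral {0<..<1} (\<lambda>t. g t ^ n)"
      using int int' sub by (intro integral_subset_le) (auto simp: g_def)
    also have "\<dots> = 1 / ((real n / \<Delta> + 1) * a n)"
      using has_integral_g_power by (rule integral_unique)
    finally show ?thesis .
  qed
  have bound: "a n * R' ^ n \<le> 1 / \<delta>" for n
  proof -
    have "a n * R' ^ n * \<delta> \<le> a n * (1 / ((real n / \<Delta> + 1) * a n))"
      using lower[of n] a_pos[of n] by (simp add: mult.assoc mult.commute mult_left_mono del: times_divide_eq_right times_divide_eq_left)
    also have "\<dots> = 1 / (real n / \<Delta> + 1)"
      using a_pos[of n] by simp
    also have "\<dots> \<le> 1"
      using \<Delta>_pos by (simp add: divide_le_eq add_nonneg_pos)
    finally show ?thesis using \<delta> by (simp add: field_simps)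
  qed
  show ?thesis
  proof (rule summable_comparison_test')
    show "summable (\<lambda>n. 1 / \<delta> * (\<bar>t\<bar> / R') ^ n)"
      using R' by (intro summable_mult summable_geometric) auto
    show "norm (a n * t ^ n) \<le> 1 / \<delta> * (\<bar>t\<bar> / R') ^ n" if "n \<ge> 0" for n
    proof -
      have "norm (a n * t ^ n) = (a n * R' ^ n) * (\<bar>t\<bar> / R') ^ n"
        using R' a_pos[of n] by (simp add: abs_mult power_abs power_divide)
      also have "\<dots> \<le> 1 / \<delta> * (\<bar>t\<bar> / R') ^ n"
        using R' by (intro mult_right_mono bound) auto
      finally show ?thesis .
    qed
  qed
qed

lemma summable_diffs_a: "\<bar>t\<bar> < R \<Longrightarrow> summable (\<lambda>n. diffs a n * t ^ n)"
  by (rule termdiff_converges[where K = R]) (auto intro: summable_a)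

text \<open>The terms do not tend to 0: the factor n + 1 from differentiation makes up for the
  linear denominator in \<open>a_R_power_ge\<close>. This excludes both endpoints R and -R as
  solutions.\<close>

lemma not_summable_diffs_a:
  assumes "R \<le> \<bar>t\<bar>"
  shows "\<not> summable (\<lambda>n. diffs a n * t ^ n)"
proof
  assume "summable (\<lambda>n. diffs a n * t ^ n)"
  then have lim: "(\<lambda>n. norm (diffs a n * t ^ n)) \<longlonglongrightarrow> 0"
    by (intro tendsto_norm_zero summable_LIMSEQ_zero)
  \<comment> \<open>The value at m = 1 of m / (m/\<Delta> + 1), which increases with m = n + 1,
    divided by R for the index shift.\<close>
  define C where "C = 1 / (1 / \<Delta> + 1) / R"
  have C: "0 < C" using \<Delta>_pos R_pos by (simp add: C_def add_pos_pos)
  have "C \<le> norm (diffs a n * t ^ n)" for n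
  proof -
    have "C * R \<le> real (Suc n) * (1 / (real (Suc n) / \<Delta> + 1))"
      using \<Delta>_pos R_pos by (simp add: C_def divide_simps) (simp add: algebra_simps)
    also have "\<dots> \<le> real (Suc n) * (a (Suc n) * R ^ Suc n)"
      by (intro mult_left_mono a_R_power_ge) auto
    also have "\<dots> = diffs a n * R ^ n * R"
      by (simp add: diffs_def)
    finally have "C \<le> diffs a n * R ^ n"
      using R_pos by simp
    also have "\<dots> \<le> diffs a n * \<bar>t\<bar> ^ n"
      using assms R_pos a_pos[of "Suc n"] by (intro mult_left_mono power_mono) (auto simp: diffs_def)
    also have "\<dots> = norm (diffs a n * t ^ n)"
      using a_pos[of "Suc n"] by (simp add: diffs_def abs_mult power_abs)
    finally show ?thesis .
  qed
  then have "C \<le> 0"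
    by (intro LIMSEQ_le_const[OF lim]) auto
  with C show False by simp
qed

text \<open>Comparison with the harmonic series: 1 / (n/\<Delta> + 1) = \<Delta> / (n + \<Delta>) is
  at least \<Delta> / (n + 1).\<close>

lemma not_summable_a_R: "\<not> summable (\<lambda>n. a n * R ^ n)"
proof
  assume "summable (\<lambda>n. a n * R ^ n)"
  moreover have "norm (\<Delta> * inverse (real (Suc n))) \<le> a n * R ^ n" for n
  proof -
    have "\<Delta> * inverse (real (Suc n)) \<le> \<Delta> / (real n + \<Delta>)"
      unfolding divide_inverse using \<Delta>_pos \<Delta>_less_1
      by (intro mult_left_mono le_imp_inverse_le) auto
    also have "\<dots> = 1 / (real n / \<Delta> + 1)"
      using \<Delta>_pos by (simp add: field_simps add_pos_nonneg)
    finally have "\<Delta> * inverse (real (Suc n)) \<le> 1 / (real n / \<Delta> + 1)" .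
    then show ?thesis
      using a_R_power_ge[of n] \<Delta>_pos by (simp add: abs_mult)
  qed
  ultimately have "summable (\<lambda>n. \<Delta> * inverse (real (Suc n)))"
    by (rule summable_comparison_test')
  then have "summable (\<lambda>n. inverse (real (Suc n)))"
    using \<Delta>_pos by (simp add: summable_cmult_iff)
  then show False
    using not_summable_harmonic[where 'a = real] by (subst (asm) summable_Suc_iff) simp
qed

section \<open>The generating function and its exponentially tilted derivative\<close>

lemma c_0: "c \<alpha> \<Delta> 0 = 1"
  by (simp add: c_def)

lemma c_1: "c \<alpha> \<Delta> (Suc 0) = 1 / \<Delta>"
proof -
  have "1 + \<alpha> / \<Delta> = 1 / \<Delta>"
    using \<Delta>_pos by (simp add: \<alpha>_def field_simps)
  moreover have "Gamma (1 / \<Delta> + 1) = 1 / \<Delta> * Gamma (1 / \<Delta>)"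
    using \<Delta>_pos by (intro Gamma_plus1) (auto dest: nonpos_Ints_nonpos)
  moreover have "Gamma (1 / \<Delta>) > 0"
    using \<Delta>_pos by simp
  ultimately show ?thesis
    by (simp add: c_def add.commute)
qed

lemma mgf_0: "mgf 0 = 1"
  unfolding mgf_def by (subst powser_zero) (simp add: a_def c_0)

lemma mgf'_0: "mgf' 0 = 1 / \<Delta>"
  unfolding mgf'_def by (subst powser_zero) (simp add: diffs_a c_1)

lemma has_field_derivative_mgf: "\<bar>t\<bar> < R \<Longrightarrow> (mgf has_field_derivative mgf' t) (at t)"
  unfolding mgf_def mgf'_def by (rule termdiffs_strong'[where K = R]) (auto intro: summable_a)

lemma isCont_tilted:
  assumes "\<bar>t\<bar> < R"
  shows "isCont (tilted r) t"
proof -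
  have "isCont mgf' t"
    unfolding mgf'_def
    by (rule DERIV_isCont, rule termdiffs_strong'[where K = R]) (use assms summable_diffs_a in auto)
  moreover have "isCont mgf t"
    using DERIV_isCont[OF has_field_derivative_mgf[OF assms]] .
  ultimately show ?thesis
    unfolding tilted_def by (intro continuous_intros) auto
qed

lemma has_field_derivative_exp_mgf:
  "\<bar>t\<bar> < R \<Longrightarrow> ((\<lambda>t. exp (- t * r) * mgf t) has_field_derivative tilted r t) (at t)"
  by (rule DERIV_cong[OF DERIV_mult, rotated 1, OF has_field_derivative_mgf, rotated 2])
     (auto intro!: derivative_eq_intros simp: tilted_def algebra_simps)

text \<open>
  Otherwise \<open>exp (- t * r) * mgf t\<close> is decreasing, so \<open>mgf\<close> is bounded on \<open>{0..<R}\<close>, and then the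
  series converges at \<open>R\<close>.
\<close>
lemma ex_tilted_nonneg: "\<exists>t. 0 \<le> t \<and> t < R \<and> 0 \<le> tilted r t"
proof (rule ccontr)
  assume "\<not> ?thesis"
  then have neg: "tilted r t \<le> 0" if "0 \<le> t" "t < R" for t
    using that by (meson linear)
  have bound: "mgf t \<le> exp (R * \<bar>r\<bar>)" if t: "0 \<le> t" "t < R" for t
  proof -
    have "exp (- t * r) * mgf t \<le> exp (- 0 * r) * mgf 0"
    proof (rule DERIV_nonpos_imp_nonincreasing[OF t(1)])
      show "\<exists>y. ((\<lambda>t. exp (- t * r) * mgf t) has_field_derivative y) (at s) \<and> y \<le> 0"
        if "0 \<le> s" "s \<le> t" for s
        using that t
        by (intro exI[of _ "tilted r s"] conjI has_field_derivative_exp_mgf neg) auto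
    qed
    then have "mgf t \<le> exp (t * r)"
      by (simp add: mgf_0 exp_minus field_simps)
    \<comment> \<open>The absolute value gives a bound uniform in t whatever the sign of r.\<close>
    also have "t * r \<le> t * \<bar>r\<bar>"
      using t by (intro mult_left_mono) auto
    also have "t * \<bar>r\<bar> \<le> R * \<bar>r\<bar>"
      using t by (intro mult_right_mono) auto
    finally show ?thesis by simp
  qed
  \<comment> \<open>Each partial sum is a polynomial, so the bound on it for t < R passes to the
    limit t = R; nonnegative terms with bounded partial sums are summable.\<close>
  have "(\<Sum>n<N. a n * R ^ n) \<le> exp (R * \<bar>r\<bar>)" for N
  proof (rule tendsto_upperbound)
    show "((\<lambda>t. \<Sum>n<N. a n * t ^ n) \<longlongrightarrow> (\<Sum>n<N. a n * R ^ n)) (at_left R)"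
      by (intro tendsto_intros)
    have "\<forall>\<^sub>F t in at_left R. t \<in> {0<..<R}"
      by (rule eventually_at_left_real[OF R_pos])
    then show "\<forall>\<^sub>F t in at_left R. (\<Sum>n<N. a n * t ^ n) \<le> exp (R * \<bar>r\<bar>)"
    proof eventually_elim
      case (elim t)
      then have "(\<Sum>n<N. a n * t ^ n) \<le> mgf t"
        unfolding mgf_def by (intro sum_le_suminf summable_a) (auto simp: a_nonneg)
      also have "\<dots> \<le> exp (R * \<bar>r\<bar>)"
        using elim by (intro bound) auto
      finally show ?case .
    qed
  qed auto
  then have "summable (\<lambda>n. a n * R ^ n)"
    by (intro summableI_nonneg_bounded[where x = "exp (R * \<bar>r\<bar>)"]) (use R_pos in \<open>auto simp: a_nonneg\<close>)
  with not_summable_a_R show False by simp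
qed

section \<open>A common form of the two equations\<close>

definition solves :: "real \<Rightarrow> real \<Rightarrow> bool" where
  "solves r t \<longleftrightarrow> summable (\<lambda>n. a n * t ^ n) \<and> summable (\<lambda>n. diffs a n * t ^ n) \<and> mgf' t / mgf t = r"

text \<open>The identity (-1)^(n+1) * t^n = - (-t)^n turns the signed series into minus the
  derivative series at -t.\<close>

lemma solves_right_iff:
  "solves_right \<alpha> \<Delta> \<epsilon> t \<longleftrightarrow> solves (1 / ((1 + \<epsilon>) powr (1 / \<Delta>) * \<Delta>)) (- t)"
proof -
  have 1: "(\<lambda>n. (- t) ^ n / fact n * c \<alpha> \<Delta> n) = (\<lambda>n. a n * (- t) ^ n)"
    by (simp add: a_def mult.commute)
  have 2: "(\<lambda>n. (- 1) ^ (n + 1) * t ^ n / fact n * c \<alpha> \<Delta> (n + 1)) = (\<lambda>n. - (diffs a n * (- t) ^ n))"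
    by (simp add: diffs_a fun_eq_iff power_minus[of t])
  show ?thesis
    unfolding solves_right_def solves_def mgf_def mgf'_def 1 2
    by (auto simp: summable_minus_iff suminf_minus)
qed

lemma solves_left_iff:
  "solves_left \<alpha> \<Delta> \<epsilon> t \<longleftrightarrow> solves (1 / ((1 - \<epsilon>) powr (1 / \<Delta>) * \<Delta>)) t"
proof -
  have 1: "(\<lambda>n. t ^ n / fact n * c \<alpha> \<Delta> n) = (\<lambda>n. a n * t ^ n)"
    by (simp add: a_def mult.commute)
  have 2: "(\<lambda>n. t ^ n / fact n * c \<alpha> \<Delta> (n + 1)) = (\<lambda>n. diffs a n * t ^ n)"
    by (simp add: diffs_a fun_eq_iff)
  show ?thesis
    unfolding solves_left_def solves_def mgf_def mgf'_def 1 2 by auto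
qed

end

section \<open>Moments of a positive stable variable\<close>

locale positive_stable = prob_space M + conjugate_exponents \<alpha> \<Delta>
  for M :: "'a measure" and \<alpha> \<Delta> :: real +
  fixes X :: "'a \<Rightarrow> real" and F :: real
  assumes F_pos: "0 < F"
    and X_measurable [measurable]: "X \<in> borel_measurable M"
    and X_pos: "AE \<omega> in M. 0 < X \<omega>"
    and laplace: "0 \<le> s \<Longrightarrow> (\<integral>\<omega>. exp (- s * X \<omega>) \<partial>M) = exp (- F * s powr \<alpha>)"
begin

lemma integrable_exp_neg: "0 \<le> s \<Longrightarrow> integrable M (\<lambda>\<omega>. exp (- s * X \<omega>))"
  using X_pos by (intro integrable_const_bound[where B = 1]) auto

lemma nn_laplace:
  "0 < s \<Longrightarrow> (\<integral>\<^sup>+\<omega>. ennreal (exp (- (X \<omega> * s))) \<partial>M) = ennreal (exp (- (F * s powr \<alpha>)))"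
  using integrable_exp_neg[of s] laplace[of s]
  by (subst nn_integral_eq_integral) (auto simp: mult.commute)

lemma nn_one_minus_laplace:
  assumes "0 < s"
  shows "(\<integral>\<^sup>+\<omega>. ennreal (1 - exp (- (X \<omega> * s))) \<partial>M) = ennreal (1 - exp (- (F * s powr \<alpha>)))"
proof (subst nn_integral_eq_integral)
  have int: "integrable M (\<lambda>\<omega>. exp (- (X \<omega> * s)))"
    using integrable_exp_neg[of s] assms by (simp add: mult.commute)
  then show "integrable M (\<lambda>\<omega>. 1 - exp (- (X \<omega> * s)))"
    by simp
  show "AE \<omega> in M. 0 \<le> 1 - exp (- (X \<omega> * s))"
    using X_pos assms by auto
  show "ennreal (\<integral>\<omega>. 1 - exp (- (X \<omega> * s)) \<partial>M) = ennreal (1 - exp (- (F * s powr \<alpha>)))"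
    using int laplace[of s] assms by (simp add: prob_space mult.commute)
qed

text \<open>
  Writing \<open>x powr l\<close> as a mixture over \<open>s\<close> of kernels \<open>\<phi> (x * s)\<close> reduces moments to the Laplace
  transform by Tonelli: \<open>\<phi> u = exp (- u)\<close> serves \<open>l < 0\<close> and \<open>\<phi> u = 1 - exp (- u)\<close> serves \<open>l > 0\<close>.
\<close>
lemma nn_moment_by_kernel:
  fixes w \<phi> :: "real \<Rightarrow> real"
  assumes [measurable]: "w \<in> borel_measurable borel" "\<phi> \<in> borel_measurable borel"
    and w: "\<And>s. 0 \<le> w s" and C: "0 < C"
    and kernel: "\<And>x. 0 < x \<Longrightarrow>
      (\<integral>\<^sup>+s\<in>{0<..}. ennreal (w s * \<phi> (x * s)) \<partial>lborel) = ennreal (C * x powr l)"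
    and expect: "\<And>s. 0 < s \<Longrightarrow> (\<integral>\<^sup>+\<omega>. ennreal (\<phi> (X \<omega> * s)) \<partial>M) = ennreal (\<phi> (F * s powr \<alpha>))"
    and total: "(\<integral>\<^sup>+s\<in>{0<..}. ennreal (w s * \<phi> (F * s powr \<alpha>)) \<partial>lborel) = ennreal V"
  shows "(\<integral>\<^sup>+\<omega>. ennreal (X \<omega> powr l) \<partial>M) = ennreal (V / C)"
proof -
  interpret pair_sigma_finite lborel M ..
  have "ennreal C * (\<integral>\<^sup>+\<omega>. ennreal (X \<omega> powr l) \<partial>M) = (\<integral>\<^sup>+\<omega>. ennreal (C * X \<omega> powr l) \<partial>M)"
    using C by (simp add: nn_integral_cmult[symmetric] ennreal_mult')
  also have "\<dots> = (\<integral>\<^sup>+\<omega>. (\<integral>\<^sup>+s\<in>{0<..}. ennreal (w s * \<phi> (X \<omega> * s)) \<partial>lborel) \<partial>M)"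
    using X_pos by (intro nn_integral_cong_AE) (auto simp: kernel)
  also have "\<dots> = (\<integral>\<^sup>+s. (\<integral>\<^sup>+\<omega>. ennreal (w s * \<phi> (X \<omega> * s)) * indicator {0<..} s \<partial>M) \<partial>lborel)"
    by (rule Fubini') measurable
  also have "\<dots> = (\<integral>\<^sup>+s\<in>{0<..}. ennreal (w s * \<phi> (F * s powr \<alpha>)) \<partial>lborel)"
  proof (intro nn_integral_cong)
    fix s :: real
    have "(\<integral>\<^sup>+\<omega>. ennreal (w s * \<phi> (X \<omega> * s)) * indicator {0<..} s \<partial>M) =
        ennreal (w s) * (\<integral>\<^sup>+\<omega>. ennreal (\<phi> (X \<omega> * s)) \<partial>M) * indicator {0<..} s"
      by (simp add: ennreal_mult'[OF w] nn_integral_cmult nn_integral_multc)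
    also have "\<dots> = ennreal (w s * \<phi> (F * s powr \<alpha>)) * indicator {0<..} s"
      by (auto split: split_indicator simp: expect ennreal_mult'[OF w])
    finally show "(\<integral>\<^sup>+\<omega>. ennreal (w s * \<phi> (X \<omega> * s)) * indicator {0<..} s \<partial>M) =
      ennreal (w s * \<phi> (F * s powr \<alpha>)) * indicator {0<..} s" .
  qed
  also have "\<dots> = ennreal C * ennreal (V / C)"
    using C by (subst ennreal_mult'[symmetric]) (auto simp: total)
  finally show ?thesis
    using C by (auto simp: ennreal_mult_cancel_left)
qed

text \<open>The cases follow the convergence of the kernel integral at s = 0: s^(-l-1) is integrable
  there only for l < 0, while for l > 0 the extra factor 1 - exp (- x * s), of order s, suffices
  because l < 1. The mixture of Laplace transforms is the same kind of integral with exponent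
  \<alpha>, where l < \<alpha> keeps \<open>Gamma (1 - l / \<alpha>)\<close> in range.\<close>

lemma nn_moment:
  assumes "l < \<alpha>"
  shows "(\<integral>\<^sup>+\<omega>. ennreal (X \<omega> powr l) \<partial>M) =
    ennreal (F powr (l / \<alpha>) * Gamma (1 - l / \<alpha>) / Gamma (1 - l))"
proof (cases l "0 :: real" rule: linorder_cases)
  case less
  have "(\<integral>\<^sup>+\<omega>. ennreal (X \<omega> powr l) \<partial>M) =
      ennreal (Gamma (- l / \<alpha>) * F powr (l / \<alpha>) / \<alpha> / Gamma (- l))"
  proof (rule nn_moment_by_kernel[where w = "\<lambda>s. s powr (- l - 1)" and \<phi> = "\<lambda>u. exp (- u)"])
    show "(\<integral>\<^sup>+s\<in>{0<..}. ennreal (s powr (- l - 1) * exp (- (x * s))) \<partial>lborel) =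
        ennreal (Gamma (- l) * x powr l)" if "0 < x" for x
    proof -
      have "(\<integral>\<^sup>+s\<in>{0<..}. ennreal (s powr (- l - 1) * exp (- (x * s))) \<partial>lborel) =
        (\<integral>\<^sup>+s\<in>{0<..}. ennreal (s powr (1 * (- l) - 1) * exp (- x * s powr 1)) \<partial>lborel)"
        by (intro nn_integral_cong) (auto split: split_indicator)
      then show ?thesis
        using nn_integral_powr_exp_powr[of 1 "- l" x] less that by simp
    qed
    show "(\<integral>\<^sup>+s\<in>{0<..}. ennreal (s powr (- l - 1) * exp (- (F * s powr \<alpha>))) \<partial>lborel) =
        ennreal (Gamma (- l / \<alpha>) * F powr (l / \<alpha>) / \<alpha>)"
      using nn_integral_powr_exp_powr[of \<alpha> "- l / \<alpha>" F] less \<alpha>_pos F_pos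
      by (simp add: divide_neg_pos)
  qed (use less nn_laplace in auto)
  also have "Gamma (- l / \<alpha>) * F powr (l / \<alpha>) / \<alpha> / Gamma (- l) =
      F powr (l / \<alpha>) * Gamma (1 - l / \<alpha>) / Gamma (1 - l)"
  proof -
    have "0 < - l / \<alpha>" using less \<alpha>_pos by (simp add: divide_neg_pos)
    then have "- l / \<alpha> \<notin> \<int>\<^sub>\<le>\<^sub>0" "- l \<notin> \<int>\<^sub>\<le>\<^sub>0"
      using less by (auto dest: nonpos_Ints_nonpos)
    \<comment> \<open>Shifting both Gamma arguments by one introduces the factors -l / \<alpha> and
      -l, whose quotient cancels the remaining 1 / \<alpha>.\<close>
    from this[THEN Gamma_plus1] have "Gamma (1 - l / \<alpha>) = (- l / \<alpha>) * Gamma (- l / \<alpha>)"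
      and "Gamma (1 - l) = - l * Gamma (- l)"
      by (simp_all add: add.commute)
    then show ?thesis
      using less by (simp add: field_simps)
  qed
  finally show ?thesis .
next
  case equal
  have "(\<integral>\<^sup>+\<omega>. ennreal (X \<omega> powr l) \<partial>M) = (\<integral>\<^sup>+\<omega>. 1 \<partial>M)"
    using X_pos equal by (intro nn_integral_cong_AE) auto
  then show ?thesis
    using equal F_pos by (simp add: emeasure_space_1)
next
  case greater
  have l: "l < 1" "0 < l / \<alpha>" "l / \<alpha> < 1"
    using greater assms \<alpha>_pos \<alpha>_less_1 by auto
  have "(\<integral>\<^sup>+\<omega>. ennreal (X \<omega> powr l) \<partial>M) =
      ennreal (F powr (l / \<alpha>) * Gamma (1 - l / \<alpha>) / l / (Gamma (1 - l) / l))"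
  proof (rule nn_moment_by_kernel[where w = "\<lambda>s. s powr (- l - 1)" and \<phi> = "\<lambda>u. 1 - exp (- u)"])
    show "(\<integral>\<^sup>+s\<in>{0<..}. ennreal (s powr (- l - 1) * (1 - exp (- (x * s)))) \<partial>lborel) =
        ennreal (Gamma (1 - l) / l * x powr l)" if "0 < x" for x
    proof -
      have "(\<integral>\<^sup>+s\<in>{0<..}. ennreal (s powr (- l - 1) * (1 - exp (- (x * s)))) \<partial>lborel) =
        (\<integral>\<^sup>+s\<in>{0<..}. ennreal (s powr (- 1 * l - 1) * (1 - exp (- x * s powr 1))) \<partial>lborel)"
        by (intro nn_integral_cong) (auto split: split_indicator)
      then show ?thesis
        using nn_integral_powr_one_minus_exp_powr[of 1 l x] greater l that by (simp add: mult.commute)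
    qed
    show "(\<integral>\<^sup>+s\<in>{0<..}. ennreal (s powr (- l - 1) * (1 - exp (- (F * s powr \<alpha>)))) \<partial>lborel) =
        ennreal (F powr (l / \<alpha>) * Gamma (1 - l / \<alpha>) / l)"
      using nn_integral_powr_one_minus_exp_powr[of \<alpha> "l / \<alpha>" F] l \<alpha>_pos F_pos by simp
  qed (use greater l nn_one_minus_laplace in \<open>auto intro!: divide_pos_pos Gamma_real_pos\<close>)
  then show ?thesis
    using greater by simp
qed

lemma has_bochner_integral_moment:
  assumes "l < \<alpha>"
  shows "has_bochner_integral M (\<lambda>\<omega>. X \<omega> powr l)
    (F powr (l / \<alpha>) * Gamma (1 - l / \<alpha>) / Gamma (1 - l))"
  using assms \<alpha>_pos \<alpha>_less_1
  by (intro has_bochner_integral_nn_integral nn_moment) (auto intro!: mult_nonneg_nonneg divide_nonneg_pos Gamma_real_pos order.strict_implies_order)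

section \<open>Power moments and exponential moments of the normalised variable\<close>

definition Y :: "'a \<Rightarrow> real" where
  "Y \<omega> = F powr (1 / \<Delta>) * X \<omega> powr (- (\<alpha> / \<Delta>))"

lemma Y_nonneg: "0 \<le> Y \<omega>"
  by (simp add: Y_def)

lemma Y_measurable [measurable]: "Y \<in> borel_measurable M"
  unfolding Y_def by measurable

text \<open>With l = - n\<alpha>/\<Delta> the moment formula contributes F^(l/\<alpha>) =
  F^(-n/\<Delta>), which the normalisation of \<open>Y\<close> cancels.\<close>

lemma has_bochner_integral_Y_power: "has_bochner_integral M (\<lambda>\<omega>. Y \<omega> ^ n) (c \<alpha> \<Delta> n)"
proof -
  define l where "l = - (real n * \<alpha> / \<Delta>)"
  have l: "l < \<alpha>"
    using \<alpha>_pos \<Delta>_pos by (simp add: l_def) (smt (verit) divide_nonneg_pos mult_nonneg_nonneg of_nat_0_le_iff)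
  have "has_bochner_integral M (\<lambda>\<omega>. F powr (real n / \<Delta>) * X \<omega> powr l)
     (F powr (real n / \<Delta>) * (F powr (l / \<alpha>) * Gamma (1 - l / \<alpha>) / Gamma (1 - l)))"
    by (intro has_bochner_integral_mult_right has_bochner_integral_moment l)
  also have "F powr (real n / \<Delta>) * (F powr (l / \<alpha>) * Gamma (1 - l / \<alpha>) / Gamma (1 - l)) = c \<alpha> \<Delta> n"
    using \<alpha>_pos F_pos by (simp add: l_def c_def powr_minus)
  finally have "has_bochner_integral M (\<lambda>\<omega>. F powr (real n / \<Delta>) * X \<omega> powr l) (c \<alpha> \<Delta> n)" .
  also have "?this \<longleftrightarrow> ?thesis"
  proof (rule has_bochner_integral_cong_AE)
    \<comment> \<open>The identity needs X > 0: at X = 0 and n = 0 the left side is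
      \<open>0 powr 0 = 0\<close> up to a factor, the right side 1.\<close>
    show "AE \<omega> in M. F powr (real n / \<Delta>) * X \<omega> powr l = Y \<omega> ^ n"
      using X_pos
    proof eventually_elim
      case (elim \<omega>)
      have "Y \<omega> ^ n = Y \<omega> powr real n"
        using elim F_pos by (subst powr_realpow) (auto simp: Y_def)
      also have "\<dots> = F powr (real n / \<Delta>) * X \<omega> powr l"
        by (simp add: Y_def powr_mult powr_powr l_def mult_ac)
      finally show ?case by simp
    qed
  qed measurable
  finally show ?thesis .
qed

text \<open>The exponential series is integrated term by term. As Y \<ge> 0, the integrals of the
  absolute values form the series at \<bar>t\<bar>, whence the shape of the hypothesis. The cases m
  = 0 and m = 1 give \<open>mgf\<close> and \<open>mgf'\<close>.\<close>

lemma has_bochner_integral_Y_power_exp: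
  assumes "summable (\<lambda>n. c \<alpha> \<Delta> (n + m) / fact n * \<bar>t\<bar> ^ n)"
  shows "has_bochner_integral M (\<lambda>\<omega>. Y \<omega> ^ m * exp (t * Y \<omega>))
    (\<Sum>n. c \<alpha> \<Delta> (n + m) / fact n * t ^ n)"
proof -
  define f where "f = (\<lambda>n \<omega>. t ^ n / fact n * Y \<omega> ^ (n + m))"
  have int: "integrable M (\<lambda>\<omega>. Y \<omega> ^ n)" and E: "(\<integral>\<omega>. Y \<omega> ^ n \<partial>M) = c \<alpha> \<Delta> n" for n
    using has_bochner_integral_Y_power[of n] by (auto simp: has_bochner_integral_iff)
  have f_sums: "(\<lambda>n. f n \<omega>) sums (Y \<omega> ^ m * exp (t * Y \<omega>))" for \<omega>
    using sums_mult[OF exp_converges[of "t * Y \<omega>"], of "Y \<omega> ^ m"]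
    by (simp add: f_def power_add power_mult_distrib divide_inverse mult_ac)
  have norm_f: "norm (f n \<omega>) = \<bar>t\<bar> ^ n / fact n * Y \<omega> ^ (n + m)" for n \<omega>
    using Y_nonneg[of \<omega>] by (simp add: f_def abs_mult power_abs)
  have AE_sum: "AE \<omega> in M. summable (\<lambda>n. norm (f n \<omega>))"
  proof (intro AE_I2)
    fix \<omega>
    show "summable (\<lambda>n. norm (f n \<omega>))"
      unfolding norm_f
      using sums_summable[OF sums_mult[OF exp_converges[of "\<bar>t\<bar> * Y \<omega>"], of "Y \<omega> ^ m"]]
      by (simp add: power_add power_mult_distrib divide_inverse mult_ac)
  qed
  have f_int: "integrable M (f n)" for n
    unfolding f_def by (intro integrable_mult_right int)
  have f_E: "(\<integral>\<omega>. f n \<omega> \<partial>M) = c \<alpha> \<Delta> (n + m) / fact n * t ^ n" for n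
    by (simp add: f_def E)
  have sum_int: "summable (\<lambda>n. \<integral>\<omega>. norm (f n \<omega>) \<partial>M)"
    using assms unfolding norm_f by (simp add: E mult.commute)
  have "(\<lambda>\<omega>. \<Sum>n. f n \<omega>) = (\<lambda>\<omega>. Y \<omega> ^ m * exp (t * Y \<omega>))"
    using f_sums by (intro ext) (rule sums_unique[symmetric])
  then show ?thesis
    using integrable_suminf[OF f_int AE_sum sum_int] integral_suminf[OF f_int AE_sum sum_int]
    by (simp add: has_bochner_integral_iff f_E)
qed

lemma has_bochner_integral_exp_Y:
  "\<bar>t\<bar> < R \<Longrightarrow> has_bochner_integral M (\<lambda>\<omega>. exp (t * Y \<omega>)) (mgf t)"
  using has_bochner_integral_Y_power_exp[of 0 t] summable_a[of "\<bar>t\<bar>"]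
  by (simp add: a_def mgf_def)

lemma has_bochner_integral_Y_exp_Y:
  "\<bar>t\<bar> < R \<Longrightarrow> has_bochner_integral M (\<lambda>\<omega>. Y \<omega> * exp (t * Y \<omega>)) (mgf' t)"
  using has_bochner_integral_Y_power_exp[of 1 t] summable_diffs_a[of "\<bar>t\<bar>"]
  by (simp add: diffs_a mgf'_def)

lemma mgf_pos: "\<bar>t\<bar> < R \<Longrightarrow> 0 < mgf t"
  using has_bochner_integral_exp_Y[of t] expectation_greater[of "\<lambda>\<omega>. exp (t * Y \<omega>)" 0]
  by (simp add: has_bochner_integral_iff)

text \<open>A constant Y = r would give c n = r^n, making the power series that of exp (r * t),
  which converges everywhere, including at R.\<close>

lemma Y_not_AE_const: "\<not> (AE \<omega> in M. Y \<omega> = r)"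
proof
  assume const: "AE \<omega> in M. Y \<omega> = r"
  have "c \<alpha> \<Delta> n = r ^ n" for n
  proof -
    have "c \<alpha> \<Delta> n = (\<integral>\<omega>. Y \<omega> ^ n \<partial>M)"
      using has_bochner_integral_Y_power by (simp add: has_bochner_integral_iff)
    also have "\<dots> = (\<integral>\<omega>. r ^ n \<partial>M)"
      using const by (intro integral_cong_AE) auto
    finally show ?thesis by (simp add: prob_space)
  qed
  then have "summable (\<lambda>n. a n * R ^ n)"
    using summable_exp_generic[of "r * R"] 
    by (simp add: a_def power_mult_distrib divide_inverse mult_ac)
  then show False
    using not_summable_a_R by simp
qed

section \<open>Monotonicity, uniqueness, sign and existence of the solution\<close>

lemma has_bochner_integral_tilted:
  assumes "\<bar>t\<bar> < R"
  shows "has_bochner_integral M (\<lambda>\<omega>. (Y \<omega> - r) * exp (t * (Y \<omega> - r))) (tilted r t)"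
proof -
  have "has_bochner_integral M (\<lambda>\<omega>. exp (- t * r) * (Y \<omega> * exp (t * Y \<omega>) - r * exp (t * Y \<omega>)))
      (tilted r t)"
    unfolding tilted_def using assms
    by (intro has_bochner_integral_mult_right has_bochner_integral_diff
          has_bochner_integral_Y_exp_Y has_bochner_integral_exp_Y)
  then show ?thesis
    by (simp add: algebra_simps exp_diff exp_minus divide_inverse)
qed

text \<open>For fixed u the map t -> u * exp (t * u) is increasing, strictly unless u = 0. With u =
  Y - r the difference \<open>h\<close> is nonnegative and vanishes only where Y = r, which is not
  almost everywhere.\<close>

lemma tilted_strict_mono:
  assumes "\<bar>s\<bar> < R" "\<bar>t\<bar> < R" "s < t"
  shows "tilted r s < tilted r t"
proof -
  define h where "h = (\<lambda>\<omega>. (Y \<omega> - r) * exp (t * (Y \<omega> - r)) - (Y \<omega> - r) * exp (s * (Y \<omega> - r)))"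
  have h: "has_bochner_integral M h (tilted r t - tilted r s)"
    unfolding h_def using assms by (intro has_bochner_integral_diff has_bochner_integral_tilted)
  have h_alt: "h \<omega> = (Y \<omega> - r) * (exp (t * (Y \<omega> - r)) - exp (s * (Y \<omega> - r)))" for \<omega>
    by (simp add: h_def algebra_simps)
  have h_pos: "0 < h \<omega>" if "Y \<omega> \<noteq> r" for \<omega>
  proof (cases "Y \<omega> < r")
    case True
    then show ?thesis
      unfolding h_alt using assms by (intro mult_neg_neg) (auto simp: mult_less_cancel_right)
  next
    case False
    with that show ?thesis
      unfolding h_alt using assms by (intro mult_pos_pos) (auto simp: mult_less_cancel_right)
  qed
  have h_nonneg: "0 \<le> h \<omega>" for \<omega>
    using h_pos[of \<omega>] by (cases "Y \<omega> = r") (auto simp: h_alt)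
  have "0 \<le> tilted r t - tilted r s"
    using h h_nonneg Bochner_Integration.integral_nonneg[of M h] by (simp add: has_bochner_integral_iff)
  moreover have "tilted r t - tilted r s \<noteq> 0"
  proof
    assume "tilted r t - tilted r s = 0"
    with h have "AE \<omega> in M. h \<omega> = 0"
      using integral_nonneg_eq_0_iff_AE[of M h] h_nonneg by (simp add: has_bochner_integral_iff)
    then have "AE \<omega> in M. Y \<omega> = r"
      by eventually_elim (use h_pos in force)
    with Y_not_AE_const show False by simp
  qed
  ultimately show ?thesis by simp
qed

text \<open>Inside the radius \<open>mgf\<close> is positive, so the quotient can be cleared;
  outside it, endpoints included, the derivative series diverges.\<close>

lemma solves_iff: "solves r t \<longleftrightarrow> \<bar>t\<bar> < R \<and> tilted r t = 0"
proof (cases "\<bar>t\<bar> < R")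
  case True
  then show ?thesis
    using mgf_pos[OF True] summable_a[OF True] summable_diffs_a[OF True]
    by (auto simp: solves_def tilted_def field_simps)
next
  case False
  then show ?thesis
    using not_summable_diffs_a[of t] by (auto simp: solves_def)
qed

lemma solves_unique: "solves r s \<Longrightarrow> solves r t \<Longrightarrow> s = t"
  using tilted_strict_mono[of s t r] tilted_strict_mono[of t s r]
  by (cases s t rule: linorder_cases) (auto simp: solves_iff)

lemma tilted_0: "tilted r 0 = 1 / \<Delta> - r"
  by (simp add: tilted_def mgf_0 mgf'_0)

text \<open>\<open>tilted r\<close> starts at 1/\<Delta> - r < 0 for t = 0 and increases, so its
  zero lies to the right of 0.\<close>

lemma solves_pos: "solves r t \<Longrightarrow> 1 / \<Delta> < r \<Longrightarrow> 0 < t"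
  using tilted_strict_mono[of t 0 r] R_pos tilted_0[of r]
  by (cases t "0 :: real" rule: linorder_cases) (auto simp: solves_iff)

lemma solves_neg: "solves r t \<Longrightarrow> r < 1 / \<Delta> \<Longrightarrow> t < 0"
  using tilted_strict_mono[of 0 t r] R_pos tilted_0[of r]
  by (cases t "0 :: real" rule: linorder_cases) (auto simp: solves_iff)

lemma ex_solves_between:
  assumes "s \<le> t" "\<bar>s\<bar> < R" "\<bar>t\<bar> < R" "tilted r s \<le> 0" "0 \<le> tilted r t"
  shows "\<exists>u. solves r u"
proof -
  have "\<exists>u. s \<le> u \<and> u \<le> t \<and> tilted r u = 0"
    using assms by (intro IVT) (auto intro!: isCont_tilted)
  then obtain u where "s \<le> u" "u \<le> t" "tilted r u = 0"
    by blast
  with assms show ?thesis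
    by (intro exI[of _ u]) (auto simp: solves_iff)
qed

lemma ex_solves_greater:
  assumes "1 / \<Delta> < r"
  shows "\<exists>t. solves r t"
proof -
  obtain t where "0 \<le> t" "t < R" "0 \<le> tilted r t"
    using ex_tilted_nonneg by blast
  then show ?thesis
    using assms R_pos by (intro ex_solves_between[of 0 t]) (auto simp: tilted_0)
qed

text \<open>At r = 1/\<Delta> the zero is t = 0, so \<open>tilted\<close> is negative at any fixed t
  in (-R, 0). By continuity in r this persists for nearby r, while the value at 0 is positive for r
  < 1/\<Delta>; a sign change follows.\<close>

lemma eventually_ex_solves_less: "\<forall>\<^sub>F r in at_left (1 / \<Delta>). \<exists>t. solves r t"
proof -
  define t where "t = - R / 2"
  have t: "\<bar>t\<bar> < R" "t < 0"
    using R_pos by (auto simp: t_def)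
  have "tilted (1 / \<Delta>) t < 0"
    using tilted_strict_mono[of t 0 "1 / \<Delta>"] t R_pos by (simp add: tilted_0)
  moreover have "isCont (\<lambda>r. tilted r t) (1 / \<Delta>)"
    unfolding tilted_def by (intro continuous_intros)
  ultimately have "\<forall>\<^sub>F r in at (1 / \<Delta>). tilted r t < 0"
    by (intro order_tendstoD) (auto simp: isCont_def)
  then have "\<forall>\<^sub>F r in at_left (1 / \<Delta>). tilted r t < 0"
    by (simp add: eventually_at_split)
  moreover have "\<forall>\<^sub>F r in at_left (1 / \<Delta>). r < 1 / \<Delta>"
    by (simp add: eventually_at_filter)
  ultimately show ?thesis
    by eventually_elim (rule ex_solves_between[of t 0], use t R_pos in \<open>auto simp: tilted_0\<close>)
qed

end

section \<open>Tail bounds\<close>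

text \<open>Markov's inequality for the product of the exp (s * Z i), whose expectation factors by
  independence. Keeping s on both sides of the inequality lets one statement serve upper tails (s >
  0) and lower tails (s < 0).\<close>

lemma (in prob_space) Chernoff_iid:
  fixes s b m :: real
  assumes indep: "indep_vars (\<lambda>_. borel) Z I" and I: "finite I"
    and exp_Z: "\<And>i. i \<in> I \<Longrightarrow> has_bochner_integral M (\<lambda>\<omega>. exp (s * Z i \<omega>)) m"
  shows "prob {\<omega> \<in> space M. s * b \<le> s * (\<Sum>i\<in>I. Z i \<omega>)} \<le> exp (- (s * b)) * m ^ card I"
proof -
  define P where "P = (\<lambda>\<omega>. \<Prod>i\<in>I. exp (s * Z i \<omega>))"
  have P: "P \<omega> = exp (s * (\<Sum>i\<in>I. Z i \<omega>))" for \<omega>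
    using I by (simp add: P_def exp_sum sum_distrib_left)
  have indep': "indep_vars (\<lambda>_. borel) (\<lambda>i \<omega>. exp (s * Z i \<omega>)) I"
    by (rule indep_vars_compose2[OF indep]) measurable
  have int: "integrable M P" 
    unfolding P_def by (rule indep_vars_integrable[OF I indep'])
      (use exp_Z in \<open>auto simp: has_bochner_integral_iff\<close>)
  have "expectation P = (\<Prod>i\<in>I. expectation (\<lambda>\<omega>. exp (s * Z i \<omega>)))"
    unfolding P_def by (rule indep_vars_lebesgue_integral[OF I indep'])
      (use exp_Z in \<open>auto simp: has_bochner_integral_iff\<close>)
  also have "\<dots> = m ^ card I"
    using exp_Z by (simp add: has_bochner_integral_iff)
  finally have E: "expectation P = m ^ card I" .
  have "{\<omega> \<in> space M. s * b \<le> s * (\<Sum>i\<in>I. Z i \<omega>)} = {\<omega> \<in> space M. exp (s * b) \<le> P \<omega>}"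
    by (simp add: P)
  also have "prob \<dots> \<le> expectation P / exp (s * b)"
    by (rule integral_Markov_inequality_measure[where A = "{}", OF int]) (auto simp: P)
  finally show ?thesis
    by (simp add: E exp_minus field_simps)
qed

lemma powr_le_powr_iff:
  fixes u v d :: real
  assumes "0 \<le> u" "0 \<le> v" "0 < d"
  shows "u powr d \<le> v powr d \<longleftrightarrow> u \<le> v"
  using assms by (metis less_imp_le not_le powr_less_mono2 powr_mono2)

text \<open>Both \<open>F_hat\<close> and A * F are \<Delta>-th powers of nonnegative numbers, so
  the bases can be compared. The estimator is decreasing in the sum, which reverses the
  inequality.\<close>

lemma
  assumes "0 < \<Delta>" "0 < A" "0 < F" "0 < k" and S: "0 < (\<Sum>j = 1..k. x j powr (- (\<alpha> / \<Delta>)))"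
  defines "T \<equiv> (\<Sum>j = 1..k. F powr (1 / \<Delta>) * x j powr (- (\<alpha> / \<Delta>)))"
  shows F_hat_ge_iff: "A * F \<le> F_hat \<alpha> \<Delta> k x \<longleftrightarrow> T \<le> real k * (1 / (A powr (1 / \<Delta>) * \<Delta>))"
    and F_hat_le_iff: "F_hat \<alpha> \<Delta> k x \<le> A * F \<longleftrightarrow> real k * (1 / (A powr (1 / \<Delta>) * \<Delta>)) \<le> T"
proof -
  define S where "S = (\<Sum>j = 1..k. x j powr (- (\<alpha> / \<Delta>)))"
  have pos: "0 < S" "0 < A powr (1 / \<Delta>)" "0 < F powr (1 / \<Delta>)"
    using assms by (simp_all add: S_def)
  have T: "T = F powr (1 / \<Delta>) * S"
    by (simp add: T_def S_def sum_distrib_left)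
  have F_hat: "F_hat \<alpha> \<Delta> k x = (real k / (\<Delta> * S)) powr \<Delta>"
    unfolding F_hat_def S_def[symmetric] using assms(1,4) pos by (simp add: powr_divide powr_mult)
  have AF: "A * F = (A powr (1 / \<Delta>) * F powr (1 / \<Delta>)) powr \<Delta>"
    using assms by (simp add: powr_mult powr_powr)
  show "A * F \<le> F_hat \<alpha> \<Delta> k x \<longleftrightarrow> T \<le> real k * (1 / (A powr (1 / \<Delta>) * \<Delta>))"
    unfolding F_hat AF T using assms(1) pos
    by (subst powr_le_powr_iff) (auto simp: field_simps)
  show "F_hat \<alpha> \<Delta> k x \<le> A * F \<longleftrightarrow> real k * (1 / (A powr (1 / \<Delta>) * \<Delta>)) \<le> T"
    unfolding F_hat AF T using assms(1) pos
    by (subst powr_le_powr_iff) (auto simp: field_simps)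
qed

section \<open>The threshold per observation\<close>

context conjugate_exponents
begin

abbreviation target :: "real \<Rightarrow> real" where
  "target A \<equiv> 1 / (A powr (1 / \<Delta>) * \<Delta>)"

lemma target_less: "1 < A \<Longrightarrow> target A < 1 / \<Delta>"
  using \<Delta>_pos powr_less_mono2[of "1 / \<Delta>" 1 A] by (simp add: field_simps)

lemma target_greater: "0 < A \<Longrightarrow> A < 1 \<Longrightarrow> 1 / \<Delta> < target A"
  using \<Delta>_pos powr_less_mono2[of "1 / \<Delta>" A 1] by (simp add: field_simps)

text \<open>Carries existence for r just below 1/\<Delta> over to small positive \<epsilon>.\<close>

lemma filterlim_target: "filterlim (\<lambda>\<epsilon>. target (1 + \<epsilon>)) (at_left (1 / \<Delta>)) (at_right 0)"
  unfolding filterlim_at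
proof
  have "\<forall>\<^sub>F \<epsilon> in at_right (0 :: real). 0 < \<epsilon>"
    by (simp add: eventually_at_filter)
  then show "\<forall>\<^sub>F \<epsilon> in at_right 0. target (1 + \<epsilon>) \<in> {..<1 / \<Delta>} \<and> target (1 + \<epsilon>) \<noteq> 1 / \<Delta>"
  proof eventually_elim
    case (elim \<epsilon>)
    then show ?case using target_less[of "1 + \<epsilon>"] by auto
  qed
  have "((\<lambda>\<epsilon>. target (1 + \<epsilon>)) \<longlongrightarrow> target (1 + 0)) (at_right 0)"
    using \<Delta>_pos by (intro tendsto_intros) auto
  then show "((\<lambda>\<epsilon>. target (1 + \<epsilon>)) \<longlongrightarrow> 1 / \<Delta>) (at_right 0)"
    by simp
qed

lemma mgf_eq: "(\<Sum>n. t ^ n / fact n * c \<alpha> \<Delta> n) = mgf t"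
  by (simp add: mgf_def a_def mult.commute)

end

section \<open>Chernoff bounds for the independent sample\<close>

locale positive_stable_sample = prob_space M + conjugate_exponents \<alpha> \<Delta>
  for M :: "'a measure" and \<alpha> \<Delta> :: real +
  fixes x :: "nat \<Rightarrow> 'a \<Rightarrow> real" and F :: real and k :: nat
  assumes F_pos: "0 < F" and k_pos: "0 < k"
    and indep: "indep_vars (\<lambda>_. borel) x {1..k}"
    and x_pos: "\<And>j. j \<in> {1..k} \<Longrightarrow> AE \<omega> in M. 0 < x j \<omega>"
    and laplace: "\<And>j s. j \<in> {1..k} \<Longrightarrow> 0 \<le> s \<Longrightarrow>
      (\<integral>\<omega>. exp (- s * x j \<omega>) \<partial>M) = exp (- F * s powr \<alpha>)"
begin

lemma positive_stable: "j \<in> {1..k} \<Longrightarrow> positive_stable M \<alpha> \<Delta> (x j) F"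
  using indep F_pos x_pos laplace
  by unfold_locales (auto simp: indep_vars_def)

definition T :: "'a \<Rightarrow> real" where
  "T \<omega> = (\<Sum>j = 1..k. F powr (1 / \<Delta>) * x j \<omega> powr (- (\<alpha> / \<Delta>)))"

lemma T_measurable [measurable]: "T \<in> borel_measurable M"
proof -
  have [measurable]: "x j \<in> borel_measurable M" if "j \<in> {1..k}" for j
    using indep that by (auto simp: indep_vars_def)
  show ?thesis
    unfolding T_def by measurable
qed

lemma AE_F_hat_iff:
  assumes "0 < A"
  shows "AE \<omega> in M. (A * F \<le> F_hat \<alpha> \<Delta> k (\<lambda>j. x j \<omega>) \<longleftrightarrow> T \<omega> \<le> real k * target A) \<and>
    (F_hat \<alpha> \<Delta> k (\<lambda>j. x j \<omega>) \<le> A * F \<longleftrightarrow> real k * target A \<le> T \<omega>)"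
proof -
  have "AE \<omega> in M. \<forall>j\<in>{1..k}. 0 < x j \<omega>"
    by (intro AE_finite_allI x_pos) auto
  then show ?thesis
  proof eventually_elim
    case (elim \<omega>)
    have "0 < (\<Sum>j = 1..k. x j \<omega> powr (- (\<alpha> / \<Delta>)))"
    proof (rule sum_pos)
      fix j assume "j \<in> {1..k}"
      with elim have "0 < x j \<omega>" by blast
      then show "0 < x j \<omega> powr (- (\<alpha> / \<Delta>))" by simp
    qed (use k_pos in auto)
    then show ?case
      unfolding T_def using assms \<Delta>_pos F_pos k_pos
      by (intro conjI F_hat_ge_iff F_hat_le_iff)
  qed
qed

lemma prob_T_le:
  assumes "\<bar>s\<bar> < R"
  shows "prob {\<omega> \<in> space M. s * (real k * r) \<le> s * T \<omega>} \<le> exp (- real k * (- ln (mgf s) + s * r))"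
proof -
  have "1 \<in> {1..k}" using k_pos by simp
  then interpret X: positive_stable M \<alpha> \<Delta> "x 1" F
    by (rule positive_stable)
  have "prob {\<omega> \<in> space M. s * (real k * r) \<le> s * T \<omega>} \<le>
      exp (- (s * (real k * r))) * mgf s ^ card {1..k}"
    unfolding T_def
  proof (rule Chernoff_iid)
    show "indep_vars (\<lambda>_. borel) (\<lambda>j \<omega>. F powr (1 / \<Delta>) * x j \<omega> powr (- (\<alpha> / \<Delta>))) {1..k}"
      by (rule indep_vars_compose2[OF indep]) measurable
    fix j assume "j \<in> {1..k}"
    then interpret Xj: positive_stable M \<alpha> \<Delta> "x j" F
      by (rule positive_stable)
    show "has_bochner_integral M (\<lambda>\<omega>. exp (s * (F powr (1 / \<Delta>) * x j \<omega> powr (- (\<alpha> / \<Delta>))))) (mgf s)"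
      using Xj.has_bochner_integral_exp_Y[OF assms] by (simp add: Xj.Y_def)
  qed auto
  \<comment> \<open>Positivity of \<open>mgf s\<close> is what permits moving the power into the
    exponent through \<open>ln\<close>.\<close>
  also have "mgf s ^ card {1..k} = exp (real k * ln (mgf s))"
    using X.mgf_pos[OF assms] by (simp add: exp_of_nat_mult)
  finally show ?thesis
    by (simp add: mult_exp_exp algebra_simps)
qed

text \<open>A large estimate means a small sum \<open>T\<close>, so the Chernoff parameter is -t. It
  is negative because the threshold lies below the mean 1/\<Delta>.\<close>

lemma right_tail:
  assumes "0 < \<epsilon>" "solves_right \<alpha> \<Delta> \<epsilon> t"
  shows "prob {\<omega> \<in> space M. (1 + \<epsilon>) * F \<le> F_hat \<alpha> \<Delta> k (\<lambda>j. x j \<omega>)} \<le>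
    exp (- real k * (- (ln (mgf (- t)) + t / ((1 + \<epsilon>) powr (1 / \<Delta>) * \<Delta>))))"
proof -
  have "1 \<in> {1..k}" using k_pos by simp
  then interpret X: positive_stable M \<alpha> \<Delta> "x 1" F
    by (rule positive_stable)
  have A: "0 < 1 + \<epsilon>" using assms by simp
  let ?r = "target (1 + \<epsilon>)"
  have sol: "solves ?r (- t)"
    using assms by (simp add: solves_right_iff)
  have t: "0 < t" "\<bar>- t\<bar> < R"
    using X.solves_neg[OF sol target_less] sol assms by (auto simp: X.solves_iff)
  have "prob {\<omega> \<in> space M. (1 + \<epsilon>) * F \<le> F_hat \<alpha> \<Delta> k (\<lambda>j. x j \<omega>)} \<le>
      prob {\<omega> \<in> space M. - t * (real k * ?r) \<le> - t * T \<omega>}"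
  \<comment> \<open>The event inclusion holds almost everywhere, where all observations are
    positive; multiplying by -t < 0 reverses the bound on \<open>T\<close>.\<close>
  proof (rule finite_measure_mono_AE)
    show "AE \<omega> in M. \<omega> \<in> {\<omega> \<in> space M. (1 + \<epsilon>) * F \<le> F_hat \<alpha> \<Delta> k (\<lambda>j. x j \<omega>)} \<longrightarrow>
        \<omega> \<in> {\<omega> \<in> space M. - t * (real k * ?r) \<le> - t * T \<omega>}"
      using AE_F_hat_iff[OF A]
    proof eventually_elim
      case (elim \<omega>)
      then show ?case
        using t by (simp add: mult_le_cancel_left_pos del: times_divide_eq_right)
    qed
  qed measurable
  also have "\<dots> \<le> exp (- real k * (- ln (mgf (- t)) + - t * ?r))"
    by (rule prob_T_le) fact
  finally show ?thesis by simp
qed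

text \<open>A small estimate means a large sum \<open>T\<close>; the threshold exceeds the mean
  1/\<Delta>, so the parameter t is positive.\<close>

lemma left_tail:
  assumes "0 < \<epsilon>" "\<epsilon> < 1" "solves_left \<alpha> \<Delta> \<epsilon> t"
  shows "prob {\<omega> \<in> space M. F_hat \<alpha> \<Delta> k (\<lambda>j. x j \<omega>) \<le> (1 - \<epsilon>) * F} \<le>
    exp (- real k * (- ln (mgf t) + t / ((1 - \<epsilon>) powr (1 / \<Delta>) * \<Delta>)))"
proof -
  have "1 \<in> {1..k}" using k_pos by simp
  then interpret X: positive_stable M \<alpha> \<Delta> "x 1" F
    by (rule positive_stable)
  have A: "0 < 1 - \<epsilon>" using assms by simp
  let ?r = "target (1 - \<epsilon>)"
  have sol: "solves ?r t"
    using assms by (simp add: solves_left_iff)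
  have t: "0 < t" "\<bar>t\<bar> < R"
    using X.solves_pos[OF sol target_greater] sol assms by (auto simp: X.solves_iff)
  have "prob {\<omega> \<in> space M. F_hat \<alpha> \<Delta> k (\<lambda>j. x j \<omega>) \<le> (1 - \<epsilon>) * F} \<le>
      prob {\<omega> \<in> space M. t * (real k * ?r) \<le> t * T \<omega>}"
  proof (rule finite_measure_mono_AE)
    show "AE \<omega> in M. \<omega> \<in> {\<omega> \<in> space M. F_hat \<alpha> \<Delta> k (\<lambda>j. x j \<omega>) \<le> (1 - \<epsilon>) * F} \<longrightarrow>
        \<omega> \<in> {\<omega> \<in> space M. t * (real k * ?r) \<le> t * T \<omega>}"
      using AE_F_hat_iff[OF A]
    proof eventually_elim
      case (elim \<omega>)
      then show ?case
        using t by (simp add: mult_le_cancel_left_pos del: times_divide_eq_right)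
    qed
  qed measurable
  also have "\<dots> \<le> exp (- real k * (- ln (mgf t) + t * ?r))"
    by (rule prob_T_le) fact
  finally show ?thesis by simp
qed

end

text \<open>
  For \<open>v = 0\<close> the witness is \<open>G = 0\<close>, with both divisions by zero giving 0.
\<close>
lemma ex_rate_denominator:
  fixes \<epsilon> v :: real
  shows "\<epsilon> \<noteq> 0 \<Longrightarrow> P v \<Longrightarrow> \<exists>G. \<epsilon>\<^sup>2 / G = v \<and> P (\<epsilon>\<^sup>2 / G)"
  by (rule exI[of _ "\<epsilon>\<^sup>2 / v"]) simp

theorem theorem3:
  fixes M :: "'a measure" and x :: "nat \<Rightarrow> 'a \<Rightarrow> real"
    and \<alpha> \<Delta> F :: real and k :: nat
  assumes "0 < \<Delta>" and "\<Delta> < 1" and "\<alpha> = 1 - \<Delta>" and "F > 0" and "k \<ge> 1"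
    and "prob_space M"
    and "prob_space.indep_vars M (\<lambda>_. borel) x {1..k}"
    and "\<And>i j. i \<in> {1..k} \<Longrightarrow> j \<in> {1..k} \<Longrightarrow> distr M borel (x i) = distr M borel (x j)"
    and "\<And>j. j \<in> {1..k} \<Longrightarrow> AE \<omega> in M. x j \<omega> > 0"
    and "\<And>j s. j \<in> {1..k} \<Longrightarrow> s \<ge> 0 \<Longrightarrow>
           (\<integral>\<omega>. exp (- s * x j \<omega>) \<partial>M) = exp (- F * s powr \<alpha>)"
  shows
    "(\<forall>j\<in>{1..k}. \<forall>l<\<alpha>. integrable M (\<lambda>\<omega>. x j \<omega> powr l) \<and>
        (\<integral>\<omega>. x j \<omega> powr l \<partial>M) = F powr (l / \<alpha>) * Gamma (1 - l / \<alpha>) / Gamma (1 - l)) \<and>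
     (\<forall>\<epsilon>>0. (\<exists>\<^sub>\<le>\<^sub>1 t\<^sub>R. solves_right \<alpha> \<Delta> \<epsilon> t\<^sub>R) \<and>
        (\<forall>t\<^sub>R. solves_right \<alpha> \<Delta> \<epsilon> t\<^sub>R \<longrightarrow>
          (\<exists>G\<^sub>R. \<epsilon>\<^sup>2 / G\<^sub>R = - (ln (\<Sum>n. (- t\<^sub>R) ^ n / fact n * c \<alpha> \<Delta> n)
                                + t\<^sub>R / ((1 + \<epsilon>) powr (1 / \<Delta>) * \<Delta>)) \<and>
            measure M {\<omega> \<in> space M. F_hat \<alpha> \<Delta> k (\<lambda>j. x j \<omega>) \<ge> (1 + \<epsilon>) * F}
              \<le> exp (- real k * (\<epsilon>\<^sup>2 / G\<^sub>R))))) \<and>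
     (\<forall>\<^sub>F \<epsilon> in at_right 0. \<exists>t\<^sub>R. solves_right \<alpha> \<Delta> \<epsilon> t\<^sub>R) \<and>
     (\<forall>\<epsilon>. 0 < \<epsilon> \<and> \<epsilon> < 1 \<longrightarrow> (\<exists>!t\<^sub>L. solves_left \<alpha> \<Delta> \<epsilon> t\<^sub>L) \<and>
        (\<forall>t\<^sub>L. solves_left \<alpha> \<Delta> \<epsilon> t\<^sub>L \<longrightarrow>
          (\<exists>G\<^sub>L. \<epsilon>\<^sup>2 / G\<^sub>L = - ln (\<Sum>n. t\<^sub>L ^ n / fact n * c \<alpha> \<Delta> n)
                               + t\<^sub>L / ((1 - \<epsilon>) powr (1 / \<Delta>) * \<Delta>) \<and>
            measure M {\<omega> \<in> space M. F_hat \<alpha> \<Delta> k (\<lambda>j. x j \<omega>) \<le> (1 - \<epsilon>) * F}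
              \<le> exp (- real k * (\<epsilon>\<^sup>2 / G\<^sub>L)))))"
proof -
  interpret prob_space M by fact
  interpret positive_stable_sample M \<alpha> \<Delta> x F k
    using assms by unfold_locales auto
  have "1 \<in> {1..k}" using k_pos by simp
  \<comment> \<open>\<open>mgf\<close> and \<open>tilted\<close> depend only on \<alpha> and
    \<Delta>, so one observation settles uniqueness and existence for the equations.\<close>
  then interpret X: positive_stable M \<alpha> \<Delta> "x 1" F
    by (rule positive_stable)
  show ?thesis
  proof (intro conjI allI ballI impI)
    fix j l assume j: "j \<in> {1..k}" and l: "l < \<alpha>"
    interpret Xj: positive_stable M \<alpha> \<Delta> "x j" F
      using j by (rule positive_stable)
    show "integrable M (\<lambda>\<omega>. x j \<omega> powr l)"
      and "(\<integral>\<omega>. x j \<omega> powr l \<partial>M) = F powr (l / \<alpha>) * Gamma (1 - l / \<alpha>) / Gamma (1 - l)"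
      using Xj.has_bochner_integral_moment[OF l] by (auto simp: has_bochner_integral_iff)
  next
    fix \<epsilon> :: real assume "0 < \<epsilon>"
    show "\<exists>\<^sub>\<le>\<^sub>1 t\<^sub>R. solves_right \<alpha> \<Delta> \<epsilon> t\<^sub>R"
      by (rule Uniq_I) (auto simp: solves_right_iff dest: X.solves_unique)
  next
    fix \<epsilon> t :: real assume "0 < \<epsilon>" "solves_right \<alpha> \<Delta> \<epsilon> t"
    then show "\<exists>G. \<epsilon>\<^sup>2 / G = - (ln (\<Sum>n. (- t) ^ n / fact n * c \<alpha> \<Delta> n)
          + t / ((1 + \<epsilon>) powr (1 / \<Delta>) * \<Delta>)) \<and>
        prob {\<omega> \<in> space M. F_hat \<alpha> \<Delta> k (\<lambda>j. x j \<omega>) \<ge> (1 + \<epsilon>) * F} \<le> exp (- real k * (\<epsilon>\<^sup>2 / G))"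
      unfolding mgf_eq by (intro ex_rate_denominator right_tail) auto
  next
    show "\<forall>\<^sub>F \<epsilon> in at_right 0. \<exists>t\<^sub>R. solves_right \<alpha> \<Delta> \<epsilon> t\<^sub>R"
      \<comment> \<open>A solution u of \<open>solves\<close> near the mean gives the right-tail
        solution -u.\<close>
      using eventually_compose_filterlim[OF X.eventually_ex_solves_less filterlim_target]
      by eventually_elim (auto simp: solves_right_iff intro: exI[of _ "- _"])
  next
    fix \<epsilon> :: real assume "0 < \<epsilon> \<and> \<epsilon> < 1"
    then obtain t where "solves_left \<alpha> \<Delta> \<epsilon> t"
      using X.ex_solves_greater[OF target_greater[of "1 - \<epsilon>"]] by (auto simp: solves_left_iff)
    then show "\<exists>!t\<^sub>L. solves_left \<alpha> \<Delta> \<epsilon> t\<^sub>L"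
      by (intro ex1I[of _ t]) (auto simp: solves_left_iff dest: X.solves_unique)
  next
    fix \<epsilon> t :: real assume "0 < \<epsilon> \<and> \<epsilon> < 1" "solves_left \<alpha> \<Delta> \<epsilon> t"
    then show "\<exists>G. \<epsilon>\<^sup>2 / G = - ln (\<Sum>n. t ^ n / fact n * c \<alpha> \<Delta> n)
          + t / ((1 - \<epsilon>) powr (1 / \<Delta>) * \<Delta>) \<and>
        prob {\<omega> \<in> space M. F_hat \<alpha> \<Delta> k (\<lambda>j. x j \<omega>) \<le> (1 - \<epsilon>) * F} \<le> exp (- real k * (\<epsilon>\<^sup>2 / G))"
      unfolding mgf_eq by (intro ex_rate_denominator left_tail) auto
  qed
qed

end
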